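(* Let $B$ be a bounded positive operator on the complex Hilbert space $\mathcal{H}$. The partially ordered set $(\mathrm{Q}(B),\leq)$ of $B$-quasi-units is a lattice.
   Context: A bounded linear operator $A$ on $\mathcal{H}$ is positive, $A\in\mathbf{B}_+(\mathcal{H})$, if $(Ax\,|\,x)\geq 0$ for all $x\in\mathcal{H}$; $A\leq B$ means $B-A$ is positive. Parallel sum: for $A,B\in\mathbf{B}_+(\mathcal{H})$, $A:B$ is the unique positive operator with $((A:B)x\,|\,x)=\inf_{y\in\mathcal{H}}\{(A(x-y)\,|\,x-y)+(By\,|\,y)\}$ for all $x\in\mathcal{H}$. Generalized short: $[A]B:=\sup_{n\in\mathbb{N}}B:(nA)$, the strong limit of the increasing sequence $(B:(nA))_n$, which is bounded above by $B$. Quasi-unit: a positive operator $A$ with $0\leq A\leq B$ is a $B$-quasi-unit if $A=[A]B$. $\mathrm{Q}(B)$ is the set of all $B$-quasi-units. Lattice means that any two elements of $\mathrm{Q}(B)$ have a greatest lower bound and a least upper bound within $\mathrm{Q}(B)$. *)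

theory Defs
  imports "HOL-Analysis.Analysis" "HOL-Algebra.Lattice"
begin

text \<open>
  Complex Hilbert spaces. The inner product \<open>cinner\<close> is linear in its first argument.
  The real inner product inherited from the library is its real part, so that the norm is
  the one induced by \<open>cinner\<close>.
\<close>

class complex_hilbert_space = real_inner + banach +
  fixes scaleC :: "complex \<Rightarrow> 'a \<Rightarrow> 'a"
    and cinner :: "'a \<Rightarrow> 'a \<Rightarrow> complex"
  assumes scaleC_add_right: "scaleC c (x + y) = scaleC c x + scaleC c y"
    and scaleC_add_left: "scaleC (c + d) x = scaleC c x + scaleC d x"
    and scaleC_scaleC: "scaleC c (scaleC d x) = scaleC (c * d) x"
    and scaleR_scaleC: "scaleR r x = scaleC (complex_of_real r) x"
    and cinner_add_left: "cinner (x + y) z = cinner x z + cinner y z"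
    and cinner_scaleC_left: "cinner (scaleC c x) y = c * cinner x y"
    and cinner_commute: "cinner x y = cnj (cinner y x)"
    and inner_eq_Re_cinner: "inner x y = Re (cinner x y)"

lemma scaleC_one: "scaleC 1 x = (x :: 'a :: complex_hilbert_space)"
  using scaleR_scaleC[of 1 x] by simp

lemma cinner_self: "cinner x x = complex_of_real ((norm x)\<^sup>2)"
proof (rule complex_eqI)
  show "Re (cinner x x) = Re (complex_of_real ((norm x)\<^sup>2))"
    by (simp add: power2_norm_eq_inner inner_eq_Re_cinner)
  have "Im (cinner x x) = Im (cnj (cinner x x))"
    using cinner_commute[of x x] by simp
  then show "Im (cinner x x) = Im (complex_of_real ((norm x)\<^sup>2))"
    by simp
qed

instantiation complex :: complex_hilbert_space
begin

definition scaleC_complex :: "complex \<Rightarrow> complex \<Rightarrow> complex"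
  where "scaleC_complex c x = c * x"

definition cinner_complex :: "complex \<Rightarrow> complex \<Rightarrow> complex"
  where "cinner_complex x y = x * cnj y"

instance
  by standard
    (auto simp: scaleC_complex_def cinner_complex_def inner_complex_def algebra_simps
      scaleR_conv_of_real)

end

definition bounded_clinear ::
    "('a::complex_hilbert_space \<Rightarrow> 'b::complex_hilbert_space) \<Rightarrow> bool"
  where "bounded_clinear A \<longleftrightarrow>
    bounded_linear A \<and> (\<forall>c x. A (scaleC c x) = scaleC c (A x))"

definition positive_op :: "('a::complex_hilbert_space \<Rightarrow> 'a) \<Rightarrow> bool"
  where "positive_op A \<longleftrightarrow>
    bounded_clinear A \<and> (\<forall>x. cinner (A x) x \<in> \<real>\<^sub>\<ge>\<^sub>0)"

definition op_le ::
    "('a::complex_hilbert_space \<Rightarrow> 'a) \<Rightarrow> ('a \<Rightarrow> 'a) \<Rightarrow> bool"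
  where "op_le A B \<longleftrightarrow> positive_op (\<lambda>x. B x - A x)"

text \<open>
  The quadratic forms of positive operators are real, so the infimum is taken over their
  real parts. The definite description is meaningful only for positive \<open>A\<close> and \<open>B\<close>.
\<close>

definition parallel_sum ::
    "('a::complex_hilbert_space \<Rightarrow> 'a) \<Rightarrow> ('a \<Rightarrow> 'a) \<Rightarrow> 'a \<Rightarrow> 'a"
  where "parallel_sum A B = (THE C. positive_op C \<and>
    (\<forall>x. cinner (C x) x = complex_of_real
      (INF y. Re (cinner (A (x - y)) (x - y)) + Re (cinner (B y) y))))"

text \<open>
  The generalized short \<open>[A]B\<close>: the supremum of the bounded increasing sequence of the
  operators \<open>B : (nA)\<close> is its limit in the strong operator topology, that is, the
  pointwise limit.
\<close>

definition generalized_short ::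
    "('a::complex_hilbert_space \<Rightarrow> 'a) \<Rightarrow> ('a \<Rightarrow> 'a) \<Rightarrow> 'a \<Rightarrow> 'a"
  where "generalized_short A B x =
    lim (\<lambda>n::nat. parallel_sum B (\<lambda>z. real n *\<^sub>R A z) x)"

definition quasi_units ::
    "('a::complex_hilbert_space \<Rightarrow> 'a) \<Rightarrow> ('a \<Rightarrow> 'a) set"
  where "quasi_units B =
    {A. positive_op A \<and> op_le A B \<and> A = generalized_short A B}"

definition quasi_unit_order ::
    "('a::complex_hilbert_space \<Rightarrow> 'a) \<Rightarrow> ('a \<Rightarrow> 'a) gorder"
  where "quasi_unit_order B = \<lparr>carrier = quasi_units B, eq = (=), le = op_le\<rparr>"

end

theory Submission
  imports Defs "HOL-Computational_Algebra.Formal_Power_Series"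
begin

text \<open>
  Let \<open>S\<close> be the square root of \<open>B\<close> and \<open>K\<close> the closure of its range. The \<open>B\<close>-quasi-units are
  exactly the operators \<open>S P S\<close> with \<open>P\<close> the projection onto a closed subspace of \<open>K\<close>, and their
  order is the inclusion of subspaces; the closed subspaces of \<open>K\<close> form a lattice.
  On the one hand \<open>B : n(S P S) = n/(n+1) S P S\<close>, so \<open>S P S\<close> is a quasi-unit. On the other hand, for
  \<open>0 \<le> A \<le> B\<close> Riesz gives vectors \<open>z x\<close> in \<open>K\<close> with \<open>(Ax | y) = (z x | S y)\<close> and
  \<open>\<parallel>z x\<parallel>\<^sup>2 \<le> (Ax | x)\<close>. If \<open>B : (nA) \<le> A\<close> for all \<open>n\<close>, equality holds in the last inequality, and
  this makes \<open>z x\<close> the projection of \<open>S x\<close> onto the closure of the range of \<open>z\<close>.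
\<close>

section \<open>Projections in real Hilbert spaces\<close>

text \<open>If \<open>t\<close> represents \<open>\<psi>\<close>, then \<open>f y\<close> equals the
  squared distance of \<open>J y\<close> from \<open>t\<close> minus the constant
  \<open>(norm t)\<^sup>2\<close>, so minimising \<open>f\<close> drives \<open>J y\<close> towards
  \<open>t\<close>. With \<open>J\<close> the identity this yields projections; with
  \<open>J\<close> a square root of \<open>B\<close> it yields the factor \<open>z\<close> of a
  quasi-unit.\<close>

lemma riesz_relative:
  fixes J :: "'b::real_vector \<Rightarrow> 'a::{real_inner,complete_space}" and \<psi> :: "'b \<Rightarrow> real"
  assumes V: "subspace V" and J: "linear J" and \<psi>: "linear \<psi>" and "0 \<le> C"
    and bound: "\<And>y. y \<in> V \<Longrightarrow> \<psi> y \<le> C * norm (J y)"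
  obtains t where "t \<in> closure (J ` V)" "\<And>y. y \<in> V \<Longrightarrow> \<psi> y = inner t (J y)" "norm t \<le> C"
proof -
  \<comment> \<open>Since \<open>J ` V\<close> need not be closed, \<open>t\<close> is the limit of a minimising sequence of \<open>f\<close>.\<close>
  define f where "f y = (norm (J y))\<^sup>2 - 2 * \<psi> y" for y
  define m where "m = Inf (f ` V)"
  have f_ge: "f y \<ge> - (C\<^sup>2)" if "y \<in> V" for y
  proof -
    have "0 \<le> (norm (J y) - C)\<^sup>2" by simp
    also have "\<dots> = (norm (J y))\<^sup>2 - 2 * (C * norm (J y)) + C\<^sup>2"
      by (simp add: power2_diff)
    finally show ?thesis using bound[OF that] by (simp add: f_def)
  qed
  have bdd: "bdd_below (f ` V)" using f_ge by (auto intro!: bdd_belowI)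
  have m_le: "m \<le> f y" if "y \<in> V" for y
    unfolding m_def using bdd that by (intro cInf_lower) auto
  have "V \<noteq> {}" using V subspace_0 by blast
  have "\<exists>y\<in>V. f y < m + inverse (real (Suc n))" for n
  proof (rule ccontr)
    assume "\<not> ?thesis"
    then have "m + inverse (real (Suc n)) \<le> Inf (f ` V)"
      using \<open>V \<noteq> {}\<close> by (intro cInf_greatest) (auto simp: not_less)
    then show False by (simp add: m_def)
  qed
  then obtain v where vV: "\<And>n. v n \<in> V" and v: "\<And>n. f (v n) < m + inverse (real (Suc n))"
    by metis
  \<comment> \<open>Parallelogram law: \<open>f\<close> at the midpoint \<open>w\<close> is at least
    \<open>m\<close>, while \<open>f (v n)\<close> and \<open>f (v k)\<close> are close to
    \<open>m\<close>.\<close>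
  have dist_le: "(norm (J (v n) - J (v k)))\<^sup>2 \<le> 2 * inverse (real (Suc n)) + 2 * inverse (real (Suc k))" for n k
  proof -
    define w where "w = (1/2::real) *\<^sub>R (v n + v k)"
    have "w \<in> V" unfolding w_def using vV V by (intro subspace_mul subspace_add)
    have "2 * f (v n) + 2 * f (v k) - 4 * f w = (norm (J (v n) - J (v k)))\<^sup>2"
      unfolding f_def w_def linear_add[OF J] linear_cmul[OF J] linear_add[OF \<psi>] linear_cmul[OF \<psi>]
      by (simp add: power2_norm_eq_inner algebra_simps inner_commute)
    then show ?thesis using m_le[OF \<open>w \<in> V\<close>] v[of n] v[of k] by simp
  qed
  have "Cauchy (\<lambda>n. J (v n))"
  proof (rule metric_CauchyI)
    fix e :: real assume "0 < e"
    then obtain N where N: "inverse (real (Suc N)) < e\<^sup>2 / 4"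
      using reals_Archimedean[of "e\<^sup>2/4"] by auto
    have "dist (J (v n)) (J (v k)) < e" if "n \<ge> N" "k \<ge> N" for n k
    proof -
      have "inverse (real (Suc n)) \<le> inverse (real (Suc N))" "inverse (real (Suc k)) \<le> inverse (real (Suc N))"
        using that by (auto simp: divide_simps)
      then have "(norm (J (v n) - J (v k)))\<^sup>2 < e\<^sup>2" using dist_le[of n k] N by linarith
      then show ?thesis using \<open>0 < e\<close> by (simp add: dist_norm power2_less_imp_less)
    qed
    then show "\<exists>M. \<forall>m\<ge>M. \<forall>n\<ge>M. dist (J (v m)) (J (v n)) < e" by blast
  qed
  then obtain t where t: "(\<lambda>n. J (v n)) \<longlonglongrightarrow> t"
    using Cauchy_convergent convergent_def by blast
  have t_cl: "t \<in> closure (J ` V)"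
    using t vV by (auto simp: closure_sequential intro!: exI[of _ "\<lambda>n. J (v n)"])
  \<comment> \<open>First variation: \<open>m\<close> is at most
    \<open>f (v n + s *\<^sub>R w)\<close>, and \<open>n\<close> tends to infinity.\<close>
  have var: "0 \<le> 2 * s * (inner t (J w) - \<psi> w) + s\<^sup>2 * (norm (J w))\<^sup>2" if "w \<in> V" for w s
  proof (rule LIMSEQ_le)
    show "(\<lambda>n. - inverse (real (Suc n))) \<longlonglongrightarrow> 0"
      using tendsto_minus[OF LIMSEQ_inverse_real_of_nat] by simp
    show "(\<lambda>n. 2 * s * (inner (J (v n)) (J w) - \<psi> w) + s\<^sup>2 * (norm (J w))\<^sup>2)
        \<longlonglongrightarrow> 2 * s * (inner t (J w) - \<psi> w) + s\<^sup>2 * (norm (J w))\<^sup>2"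
      by (intro tendsto_intros t)
    have "- inverse (real (Suc n)) \<le> 2 * s * (inner (J (v n)) (J w) - \<psi> w) + s\<^sup>2 * (norm (J w))\<^sup>2" for n
    proof -
      have "v n + s *\<^sub>R w \<in> V" using that vV V by (intro subspace_mul subspace_add)
      from m_le[OF this] have "m \<le> f (v n) + (2 * s * (inner (J (v n)) (J w) - \<psi> w) + s\<^sup>2 * (norm (J w))\<^sup>2)"
        unfolding f_def linear_add[OF J] linear_cmul[OF J] linear_add[OF \<psi>] linear_cmul[OF \<psi>] power2_norm_eq_inner
        by (simp add: power2_eq_square algebra_simps inner_commute)
      then show ?thesis using v[of n] by linarith
    qed
    then show "\<exists>N. \<forall>n\<ge>N. - inverse (real (Suc n))
        \<le> 2 * s * (inner (J (v n)) (J w) - \<psi> w) + s\<^sup>2 * (norm (J w))\<^sup>2" by blast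
  qed
  have eq: "\<psi> w = inner t (J w)" if "w \<in> V" for w
  proof -
    define d where "d = inner t (J w) - \<psi> w"
    define N where "N = (norm (J w))\<^sup>2"
    \<comment> \<open>This \<open>s\<close> is nearly the minimiser \<open>- d / N\<close> of the
      quadratic in \<open>var\<close>; the \<open>+ 1\<close> keeps it defined when
      \<open>J w = 0\<close> and still makes the value negative unless \<open>d = 0\<close>.\<close>
    have "0 \<le> 2 * (- d / (N + 1)) * d + (- d / (N + 1))\<^sup>2 * N"
      using var[OF that, of "- d / (N + 1)"] by (simp add: d_def N_def)
    moreover have "N \<ge> 0" by (simp add: N_def)
    ultimately have "0 \<le> (2 * (- d / (N + 1)) * d + (- d / (N + 1))\<^sup>2 * N) * (N + 1)\<^sup>2" by simp
    also have "\<dots> = - (d\<^sup>2 * (N + 2))"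
      using \<open>N \<ge> 0\<close> by (simp add: field_simps power2_eq_square add_nonneg_eq_0_iff)
    finally have "d\<^sup>2 * (N + 2) \<le> 0" by simp
    then have "d = 0" using \<open>N \<ge> 0\<close> by (simp add: mult_le_0_iff)
    then show ?thesis by (simp add: d_def)
  qed
  \<comment> \<open>By continuity the bound extends from the image of \<open>V\<close> to its
    closure and so applies to \<open>t\<close> itself.\<close>
  have "closed {u. inner t u \<le> C * norm u}"
    by (intro closed_Collect_le continuous_intros)
  moreover have "J ` V \<subseteq> {u. inner t u \<le> C * norm u}" using bound eq by auto
  ultimately have "inner t t \<le> C * norm t"
    using t_cl closure_minimal by blast
  then have "norm t * norm t \<le> C * norm t" by (simp add: power2_norm_eq_inner[symmetric] power2_eq_square)
  then have "norm t \<le> C" using \<open>0 \<le> C\<close> by (cases "t = 0") auto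
  with t_cl eq show ?thesis using that by blast
qed

text \<open>\<open>s - t\<close> is orthogonal to \<open>V\<close>, by continuity also to
  \<open>s\<close> and \<open>t\<close>, hence to itself. This gives the uniqueness of projections
  and the linearity of \<open>z\<close> further down.\<close>

lemma closure_eqI_inner:
  fixes s t :: "'a::real_inner"
  assumes "s \<in> closure V" "t \<in> closure V" and eq: "\<And>v. v \<in> V \<Longrightarrow> inner s v = inner t v"
  shows "s = t"
proof -
  have "closed {v. inner (s - t) v = 0}" by (intro closed_Collect_eq continuous_intros)
  moreover have "V \<subseteq> {v. inner (s - t) v = 0}" using eq by (auto simp: inner_diff_left)
  ultimately have "inner (s - t) s = 0" "inner (s - t) t = 0"
    using assms(1,2) closure_minimal by blast+
  then have "inner (s - t) (s - t) = 0" by (simp only: inner_diff_right)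
  then show ?thesis by simp
qed

text \<open>Only the real inner product enters. Complex linearity is recovered by
  \<open>proj_commute\<close> for subspaces stable under multiplication by the imaginary
  unit.\<close>

definition proj :: "'a::{real_inner,complete_space} set \<Rightarrow> 'a \<Rightarrow> 'a"
  where "proj M x = (SOME p. p \<in> M \<and> (\<forall>m\<in>M. inner (x - p) m = 0))"

context
  fixes M :: "'a::{real_inner,complete_space} set"
  assumes M: "subspace M" "closed M"
begin

lemma proj_ex: "\<exists>p. p \<in> M \<and> (\<forall>m\<in>M. inner (x - p) m = 0)"
proof -
  obtain t where "t \<in> closure ((\<lambda>v. v) ` M)" "\<And>y. y \<in> M \<Longrightarrow> inner x y = inner t y"
    by (rule riesz_relative[of M "\<lambda>v. v" "inner x" "norm x"])
      (use M in \<open>auto simp: linear_ident norm_cauchy_schwarz intro!: bounded_linear.linear bounded_linear_inner_right\<close>)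
  then show ?thesis using M by (intro exI[of _ t]) (auto simp: inner_diff_left)
qed

lemma proj_in: "proj M x \<in> M"
  and proj_orth: "m \<in> M \<Longrightarrow> inner (x - proj M x) m = 0"
  using someI_ex[OF proj_ex[of x]] unfolding proj_def by auto

lemma proj_unique:
  assumes "p \<in> M" "\<And>m. m \<in> M \<Longrightarrow> inner (x - p) m = 0"
  shows "proj M x = p"
proof (rule closure_eqI_inner)
  show "proj M x \<in> closure M" "p \<in> closure M" using assms(1) proj_in closure_subset by auto
  show "inner (proj M x) v = inner p v" if "v \<in> M" for v
    using assms(2)[OF that] proj_orth[OF that, of x] by (simp add: inner_diff_left)
qed

lemma proj_id: "x \<in> M \<Longrightarrow> proj M x = x"
  by (rule proj_unique) auto

lemma proj_linear: "linear (proj M)"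
proof (rule linearI)
  show "proj M (x + y) = proj M x + proj M y" for x y
  proof (rule proj_unique)
    show "proj M x + proj M y \<in> M" using M proj_in by (intro subspace_add)
    show "inner (x + y - (proj M x + proj M y)) m = 0" if "m \<in> M" for m
      using proj_orth[OF that, of x] proj_orth[OF that, of y] by (simp add: algebra_simps)
  qed
  show "proj M (r *\<^sub>R x) = r *\<^sub>R proj M x" for r x
  proof (rule proj_unique)
    show "r *\<^sub>R proj M x \<in> M" using M proj_in by (intro subspace_mul)
    show "inner (r *\<^sub>R x - r *\<^sub>R proj M x) m = 0" if "m \<in> M" for m
      using proj_orth[OF that, of x] by (simp flip: scaleR_diff_right)
  qed
qed

lemma inner_proj: "inner (proj M x) y = inner (proj M x) (proj M y)"
  using proj_orth[OF proj_in, of y x] by (simp add: inner_diff_right inner_diff_left inner_commute[of y] inner_commute[of "proj M y"])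

lemma norm_proj_Pythagoras: "(norm x)\<^sup>2 = (norm (proj M x))\<^sup>2 + (norm (x - proj M x))\<^sup>2"
  using inner_proj[of x x] by (simp add: power2_norm_eq_inner algebra_simps inner_commute)

lemma norm_proj_le: "norm (proj M x) \<le> norm x"
  by (rule power2_le_imp_le) (use norm_proj_Pythagoras[of x] in auto)

lemma proj_bounded_linear: "bounded_linear (proj M)"
  using proj_linear norm_proj_le
  by (intro bounded_linear_intro[where K = 1]) (auto simp: linear_add linear_cmul)

end

section \<open>Square roots of positive operators\<close>

text \<open>Symmetry is demanded explicitly: over the reals it does not follow from nonnegativity of
  the form, as it does over the complex numbers (\<open>positive_op_iff\<close>).\<close>

definition psd :: "('a::real_inner \<Rightarrow> 'a) \<Rightarrow> bool"
  where "psd A \<longleftrightarrow> bounded_linear A \<and> (\<forall>x y. inner (A x) y = inner x (A y)) \<and> (\<forall>x. 0 \<le> inner (A x) x)"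

lemma psdD:
  assumes "psd A"
  shows "bounded_linear A" "linear A" "inner (A x) y = inner x (A y)" "0 \<le> inner (A x) x"
  using assms bounded_linear.linear by (auto simp: psd_def)

lemma psd_Cauchy_Schwarz:
  assumes "psd A"
  shows "(inner (A x) y)\<^sup>2 \<le> inner (A x) x * inner (A y) y"
proof -
  note lin = linear_add[OF psdD(2)[OF assms]] linear_cmul[OF psdD(2)[OF assms]]
  define a b c where "a = inner (A x) x" and "b = inner (A x) y" and "c = inner (A y) y"
  have b': "inner (A y) x = b" using psdD(3)[OF assms, of y x] by (simp add: b_def inner_commute)
  have q: "0 \<le> a + 2 * s * b + s\<^sup>2 * c" for s
    using psdD(4)[OF assms, of "x + s *\<^sub>R y"] b'
    by (simp add: lin a_def b_def c_def algebra_simps power2_eq_square)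
  have "a \<ge> 0" "c \<ge> 0" using psdD(4)[OF assms] by (auto simp: a_def c_def)
  have "b\<^sup>2 \<le> a * c"
  proof (cases "c = 0")
    case True
    have "b = 0"
    proof (rule ccontr)
      assume "b \<noteq> 0"
      \<comment> \<open>With \<open>c = 0\<close> the form is affine in \<open>s\<close>; this
        \<open>s\<close> gives it the value -1.\<close>
      then show False using q[of "- (a + 1) / (2 * b)"] True \<open>a \<ge> 0\<close> by (simp add: field_simps)
    qed
    then show ?thesis using True by simp
  next
    case False
    have "0 \<le> (a + 2 * (- b / c) * b + (- b / c)\<^sup>2 * c) * c"
      by (rule mult_nonneg_nonneg[OF q \<open>c \<ge> 0\<close>])
    also have "\<dots> = a * c - b\<^sup>2" using False by (simp add: field_simps power2_eq_square)
    finally show ?thesis by simp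
  qed
  then show ?thesis by (simp add: a_def b_def c_def)
qed

text \<open>Cauchy-Schwarz for the form of \<open>A\<close> with \<open>y = A x\<close>, followed by
  cancelling \<open>(norm (A x))\<^sup>2\<close>. It lets quadratic forms control norms.\<close>

lemma psd_norm_square_le:
  assumes "psd A" and le: "\<And>x. inner (A x) x \<le> K * (norm x)\<^sup>2"
  shows "(norm (A x))\<^sup>2 \<le> K * inner (A x) x"
proof (cases "A x = 0")
  case False
  have "((norm (A x))\<^sup>2)\<^sup>2 \<le> inner (A x) x * inner (A (A x)) (A x)"
    using psd_Cauchy_Schwarz[OF assms(1), of x "A x"] by (simp add: power2_norm_eq_inner)
  also have "\<dots> \<le> inner (A x) x * (K * (norm (A x))\<^sup>2)"
    using psdD(4)[OF assms(1)] le by (intro mult_left_mono)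
  finally have "(norm (A x))\<^sup>2 * (norm (A x))\<^sup>2 \<le> (K * inner (A x) x) * (norm (A x))\<^sup>2"
    by (simp add: power2_eq_square mult_ac)
  then show ?thesis by (rule mult_right_le_imp_le) (use False in simp)
qed (use psdD(1)[OF assms(1)] in auto)

lemma psd_contraction:
  assumes "psd A" and "\<And>x. inner (A x) x \<le> (norm x)\<^sup>2"
  shows "norm (A x) \<le> norm x"
proof -
  have "(norm (A x))\<^sup>2 \<le> inner (A x) x" using psd_norm_square_le[of A 1] assms by simp
  also have "\<dots> \<le> (norm x)\<^sup>2" by (rule assms)
  finally show ?thesis by (rule power2_le_imp_le) simp
qed

text \<open>
  \<open>sqrt (1 - z) = (\<Sum>k. sqrt_coeff k * z ^ k)\<close>, absolutely convergent up to the boundary \<open>\<bar>z\<bar> = 1\<close>;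
  it is applied to \<open>z = 1 - B / c\<close> with \<open>c\<close> a bound for \<open>B\<close>.
\<close>

definition sqrt_coeff :: "nat \<Rightarrow> real"
  where "sqrt_coeff k = ((1/2) gchoose k) * (-1) ^ k"

text \<open>The binomial recursion multiplies each coefficient by a nonnegative ratio, so the sign
  of \<open>sqrt_coeff 1 = -1/2\<close> propagates.\<close>

lemma sqrt_coeff_nonpos: "sqrt_coeff (Suc k) \<le> 0"
proof (induction k)
  case 0
  show ?case by (simp add: sqrt_coeff_def)
next
  case (Suc k)
  have "real (Suc (Suc k)) * ((1/2) gchoose Suc (Suc k)) = (1/2 - real (Suc k)) * ((1/2) gchoose Suc k)"
    using gbinomial_mult_1[of "1/2::real" "Suc k"] by (simp only: left_diff_distrib)
  then have "real (Suc (Suc k)) * sqrt_coeff (Suc (Suc k)) = (real (Suc k) - 1/2) * sqrt_coeff (Suc k)"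
    unfolding sqrt_coeff_def power_Suc[of _ "Suc k"] by (simp add: mult.assoc[symmetric] left_diff_distrib distrib_right distrib_left)
  moreover have "(real (Suc k) - 1/2) * sqrt_coeff (Suc k) \<le> 0"
    using Suc by (intro mult_nonneg_nonpos) auto
  ultimately have "real (Suc (Suc k)) * sqrt_coeff (Suc (Suc k)) \<le> 0" by simp
  then show ?case by (simp add: mult_le_0_iff del: of_nat_Suc)
qed

text \<open>Only the coefficient at 0 is positive, so the absolute partial sums are 2 minus the
  signed ones. The latter have the closed form \<open>(-1) ^ n * ((-1/2) gchoose n)\<close>, which
  is nonnegative.\<close>

lemma summable_sqrt_coeff: "summable (\<lambda>k. \<bar>sqrt_coeff k\<bar>)"
proof -
  have "(\<Sum>k<n. \<bar>sqrt_coeff k\<bar>) \<le> 2" for n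
  proof -
    have nonneg: "0 \<le> (-1) ^ n * ((-1/2) gchoose n :: real)" for n
    proof -
      have "(-1) ^ n * ((-1/2) gchoose n :: real) = ((-1) ^ n * (-1) ^ n) * (pochhammer (1/2) n / fact n)"
        by (simp only: gbinomial_pochhammer) simp
      also have "(-1) ^ n * (-1) ^ n = (1::real)" by (simp flip: power_mult_distrib)
      finally show ?thesis by (simp add: pochhammer_nonneg)
    qed
    have "(\<Sum>k\<le>n. \<bar>sqrt_coeff k\<bar>) = 2 - (\<Sum>k\<le>n. sqrt_coeff k)"
    proof (induction n)
      case (Suc n)
      then show ?case using sqrt_coeff_nonpos[of n] by simp
    qed (simp add: sqrt_coeff_def)
    moreover have "(\<Sum>k\<le>n. sqrt_coeff k) \<ge> 0"
      using nonneg[of n] by (simp add: sqrt_coeff_def gbinomial_sum_lower_neg)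
    moreover have "(\<Sum>k<n. \<bar>sqrt_coeff k\<bar>) \<le> (\<Sum>k\<le>n. \<bar>sqrt_coeff k\<bar>)"
      by (intro sum_mono2) auto
    ultimately show ?thesis by linarith
  qed
  then show ?thesis by (intro summableI_nonneg_bounded) auto
qed

text \<open>These are the coefficients of \<open>1 - z\<close>, the square of the series;
  Vandermonde's identity with \<open>1/2 + 1/2 = 1\<close> computes them.\<close>

lemma sqrt_coeff_conv:
  "(\<Sum>k\<le>n. sqrt_coeff k * sqrt_coeff (n - k)) = (if n = 0 then 1 else if n = 1 then -1 else 0)"
proof -
  have "(\<Sum>k\<le>n. sqrt_coeff k * sqrt_coeff (n - k))
      = (\<Sum>k\<le>n. (-1) ^ n * (((1/2) gchoose k) * ((1/2) gchoose (n - k))))"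
    by (intro sum.cong refl) (auto simp: sqrt_coeff_def power_add[symmetric])
  also have "\<dots> = (-1) ^ n * ((1::real) gchoose n)"
    using gbinomial_Vandermonde[of "1/2::real" "1/2::real" n] by (simp add: sum_distrib_left[symmetric] atLeast0AtMost)
  also have "(1::real) gchoose n = (if n = 0 then 1 else if n = 1 then 1 else 0)"
  proof -
    have "(1::real) gchoose n = real (1 choose n)" using binomial_gbinomial[of 1 n, where 'a = real] by simp
    then show ?thesis by (cases n rule: nat.exhaust[case_names 0 Suc]) (auto simp: binomial_eq_0)
  qed
  finally show ?thesis by (auto split: if_splits)
qed

section \<open>The operator series for the square root of \<open>1 - X\<close>, for a contraction
  \<open>X\<close>\<close>

context
  fixes X :: "'a::{real_inner,banach} \<Rightarrow> 'a"
  assumes X: "bounded_linear X" and X_le: "\<And>x. norm (X x) \<le> norm x"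
begin

definition sqrt_series :: "'a \<Rightarrow> 'a"
  where "sqrt_series x = (\<Sum>k. sqrt_coeff k *\<^sub>R (X ^^ k) x)"

lemma bounded_linear_funpow: "bounded_linear (X ^^ k)"
proof (induction k)
  case (Suc k)
  then show ?case using bounded_linear_compose[OF X, of "X ^^ k"] by (simp add: o_def)
qed (simp add: id_def)

lemma norm_funpow_le: "norm ((X ^^ k) x) \<le> norm x"
proof (induction k)
  case (Suc k)
  then show ?case using X_le[of "(X ^^ k) x"] by simp
qed simp

lemma norm_term_le: "norm (sqrt_coeff k *\<^sub>R (X ^^ k) x) \<le> \<bar>sqrt_coeff k\<bar> * norm x"
  using norm_funpow_le[of k x] by (simp add: mult_left_mono)

lemma summable_norm_terms: "summable (\<lambda>k. norm (sqrt_coeff k *\<^sub>R (X ^^ k) x))"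
  by (rule summable_comparison_test'[OF summable_mult2[OF summable_sqrt_coeff, of "norm x"], of 0])
    (use norm_term_le in auto)

lemma summable_terms: "summable (\<lambda>k. sqrt_coeff k *\<^sub>R (X ^^ k) x)"
  by (rule summable_norm_cancel[OF summable_norm_terms])

lemma bounded_linear_sqrt_series: "bounded_linear sqrt_series"
proof (rule bounded_linear_intro)
  have lin: "linear (X ^^ k)" for k by (rule bounded_linear.linear[OF bounded_linear_funpow])
  show "sqrt_series (x + y) = sqrt_series x + sqrt_series y" for x y
    unfolding sqrt_series_def suminf_add[OF summable_terms summable_terms]
    by (simp add: linear_add[OF lin] scaleR_add_right)
  show "sqrt_series (r *\<^sub>R x) = r *\<^sub>R sqrt_series x" for r x
    unfolding sqrt_series_def suminf_scaleR_right[OF summable_terms]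
    by (simp add: linear_cmul[OF lin] mult.commute)
  show "norm (sqrt_series x) \<le> norm x * (\<Sum>k. \<bar>sqrt_coeff k\<bar>)" for x
  proof -
    have "norm (sqrt_series x) \<le> (\<Sum>k. norm (sqrt_coeff k *\<^sub>R (X ^^ k) x))"
      unfolding sqrt_series_def by (rule summable_norm[OF summable_norm_terms])
    also have "\<dots> \<le> (\<Sum>k. \<bar>sqrt_coeff k\<bar> * norm x)"
      by (intro suminf_le norm_term_le summable_norm_terms summable_mult2 summable_sqrt_coeff)
    also have "\<dots> = norm x * (\<Sum>k. \<bar>sqrt_coeff k\<bar>)"
      using suminf_mult2[OF summable_sqrt_coeff, of "norm x"] by (simp add: mult.commute)
    finally show ?thesis .
  qed
qed

lemma bounded_linear_apply_sqrt_series: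
  assumes "bounded_linear U"
  shows "U (sqrt_series x) = (\<Sum>k. sqrt_coeff k *\<^sub>R U ((X ^^ k) x))"
  unfolding sqrt_series_def bounded_linear.suminf[OF assms summable_terms]
  by (simp add: linear_cmul[OF bounded_linear.linear[OF assms]])

lemma sqrt_series_commute:
  assumes U: "bounded_linear U" and comm: "\<And>x. U (X x) = X (U x)"
  shows "U (sqrt_series x) = sqrt_series (U x)"
proof -
  have "U ((X ^^ k) x) = (X ^^ k) (U x)" for k by (induction k) (auto simp: comm)
  then show ?thesis by (simp add: bounded_linear_apply_sqrt_series[OF U]) (simp add: sqrt_series_def)
qed

lemma sqrt_series_symmetric:
  assumes sym: "\<And>x y. inner (X x) y = inner x (X y)"
  shows "inner (sqrt_series x) y = inner x (sqrt_series y)"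
proof -
  have "inner ((X ^^ k) x) y = inner x ((X ^^ k) y)" for k
    by (induction k arbitrary: y) (auto simp: sym funpow_swap1[symmetric])
  then show ?thesis
    using bounded_linear_apply_sqrt_series[OF bounded_linear_inner_left[of y], of x]
      bounded_linear_apply_sqrt_series[OF bounded_linear_inner_right[of x], of y] by simp
qed

text \<open>A Cauchy product: the double family \<open>f\<close> is absolutely summable, and its sum
  \<open>T\<close> is evaluated once by rows and once along the diagonals
  \<open>j + k = n\<close>.\<close>

lemma sqrt_series_sqrt_series: "sqrt_series (sqrt_series x) = x - X x"
proof -
  let ?c = sqrt_coeff
  define f where "f = (\<lambda>(j, k). (?c j * ?c k) *\<^sub>R (X ^^ (j + k)) x)"
  define L where "L = (\<Sum>k. \<bar>?c k\<bar>)"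
  have c_sum: "((\<lambda>k. \<bar>?c k\<bar>) has_sum L) UNIV"
    unfolding L_def using summable_sqrt_coeff
    by (intro norm_summable_imp_has_sum summable_sums) auto
  have "(\<lambda>(j, k). \<bar>?c j\<bar> * \<bar>?c k\<bar> * norm x) summable_on (UNIV \<times> UNIV)"
  proof (rule summable_on_SigmaI)
    show "((\<lambda>k. case (j, k) of (j, k) \<Rightarrow> \<bar>?c j\<bar> * \<bar>?c k\<bar> * norm x) has_sum \<bar>?c j\<bar> * L * norm x) UNIV" for j
      using c_sum by (auto intro: has_sum_cmult_left has_sum_cmult_right)
    show "(\<lambda>j. \<bar>?c j\<bar> * L * norm x) summable_on UNIV"
      using c_sum by (intro summable_on_cmult_left) (auto simp: summable_on_def)
  qed auto
  then have "f summable_on UNIV \<times> UNIV"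
    unfolding f_def
    by (rule abs_summable_summable[OF summable_on_comparison_test])
      (auto simp: abs_mult intro!: mult_left_mono norm_funpow_le)
  then obtain T where T: "(f has_sum T) (UNIV \<times> UNIV)" by (auto simp: summable_on_def)
  \<comment> \<open>Row sums: for fixed \<open>j\<close>, continuity of \<open>X ^^ j\<close>
    collects the inner sum into \<open>sqrt_series x\<close>.\<close>
  have "((\<lambda>j. ?c j *\<^sub>R (X ^^ j) (sqrt_series x)) has_sum T) UNIV"
  proof (rule has_sum_SigmaD[OF T])
    fix j
    have "((\<lambda>k. ?c k *\<^sub>R (X ^^ k) x) has_sum sqrt_series x) UNIV"
      unfolding sqrt_series_def
      by (intro norm_summable_imp_has_sum summable_norm_terms summable_sums summable_terms)
    from has_sum_bounded_linear[OF bounded_linear_compose[OF bounded_linear_scaleR_right bounded_linear_funpow] this]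
    have "((\<lambda>k. ?c j *\<^sub>R (X ^^ j) (?c k *\<^sub>R (X ^^ k) x)) has_sum ?c j *\<^sub>R (X ^^ j) (sqrt_series x)) UNIV" .
    then show "((\<lambda>k. f (j, k)) has_sum ?c j *\<^sub>R (X ^^ j) (sqrt_series x)) UNIV"
      by (simp add: f_def linear_cmul[OF bounded_linear.linear[OF bounded_linear_funpow]] funpow_add)
  qed
  then have T1: "T = sqrt_series (sqrt_series x)"
    using has_sum_imp_sums sums_unique unfolding sqrt_series_def[of "sqrt_series x"] by blast
  \<comment> \<open>Diagonal sums: \<open>(j, k)\<close> becomes \<open>(j + k, j)\<close>, so the
    inner sums are finite and \<open>sqrt_coeff_conv\<close> leaves only the terms for 0 and
    1.\<close>
  have "((\<lambda>(n, k). f (k, n - k)) has_sum T) (SIGMA n:UNIV. {..n})"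
    using T
    by (subst has_sum_reindex_bij_witness[where T = "UNIV \<times> UNIV" and h = f and s' = T
          and i = "\<lambda>(j, k). (j + k, j)" and j = "\<lambda>(n, k). (k, n - k)"]) auto
  then have "((\<lambda>n. \<Sum>k\<le>n. f (k, n - k)) has_sum T) UNIV"
    by (rule has_sum_SigmaD) auto
  moreover have "(\<Sum>k\<le>n. f (k, n - k)) = (if n = 0 then x else if n = 1 then - X x else 0)" for n
  proof -
    have "(\<Sum>k\<le>n. f (k, n - k)) = (\<Sum>k\<le>n. ?c k * ?c (n - k)) *\<^sub>R (X ^^ n) x"
      unfolding scaleR_sum_left f_def by (intro sum.cong) auto
    then show ?thesis by (simp add: sqrt_coeff_conv)
  qed
  ultimately have "(\<lambda>n. if n = 0 then x else if n = 1 then - X x else 0) sums T"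
    using has_sum_imp_sums by force
  moreover have "(\<lambda>n. if n = 0 then x else if n = 1 then - X x else 0) sums (x - X x)"
    using sums_finite[of "{0, 1::nat}" "\<lambda>n. if n = 0 then x else if n = 1 then - X x else 0"] by auto
  ultimately show ?thesis using T1 sums_unique2 by blast
qed

end

text \<open>The last clause carries complex linearity from \<open>B\<close> to \<open>S\<close>: it
  will be applied with \<open>U\<close> multiplication by the imaginary unit.\<close>

lemma psd_sqrt:
  fixes B :: "'a::{real_inner,banach} \<Rightarrow> 'a"
  assumes B: "psd B"
  obtains S where "bounded_linear S" "\<And>x y. inner (S x) y = inner x (S y)" "\<And>x. S (S x) = B x"
    "\<And>U x. bounded_linear U \<Longrightarrow> (\<And>x. U (B x) = B (U x)) \<Longrightarrow> U (S x) = S (U x)"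
proof -
  obtain K where "K > 0" and K: "\<And>x. norm (B x) \<le> norm x * K"
    using bounded_linear.pos_bounded[OF psdD(1)[OF B]] by blast
  define X where "X x = x - (1 / K) *\<^sub>R B x" for x
  have X: "bounded_linear X"
    unfolding X_def
    by (intro bounded_linear_sub bounded_linear_ident bounded_linear_const_scaleR psdD(1)[OF B])
  have sym: "inner (X x) y = inner x (X y)" for x y
    using psdD(3)[OF B, of x y] by (simp add: X_def inner_diff_left inner_diff_right)
  have "inner (B x) x \<le> K * (norm x)\<^sup>2" for x
    using order_trans[OF norm_cauchy_schwarz mult_right_mono[OF K norm_ge_zero], of x x]
    by (simp add: power2_eq_square mult_ac)
  then have "0 \<le> inner (X x) x" for x
    using \<open>K > 0\<close> by (simp add: X_def inner_diff_left power2_norm_eq_inner[symmetric] divide_le_eq mult.commute)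
  then have "psd X" using X sym by (simp add: psd_def)
  moreover have "inner (X x) x \<le> (norm x)\<^sup>2" for x
    using psdD(4)[OF B, of x] \<open>K > 0\<close> by (simp add: X_def inner_diff_left power2_norm_eq_inner)
  ultimately have X_le: "norm (X x) \<le> norm x" for x by (rule psd_contraction)
  \<comment> \<open>The series is a root of \<open>1 - X\<close>, which is \<open>B\<close> divided
    by \<open>K\<close>; the factor \<open>sqrt K\<close> undoes this scaling.\<close>
  define S where "S x = sqrt K *\<^sub>R sqrt_series X x" for x
  note bl = bounded_linear_sqrt_series[OF X X_le]
  show ?thesis
  proof (rule that)
    show "bounded_linear S"
      unfolding S_def by (intro bounded_linear_const_scaleR bl)
    show "inner (S x) y = inner x (S y)" for x y
      using sqrt_series_symmetric[OF X X_le sym] by (simp add: S_def)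
    show "S (S x) = B x" for x
      using \<open>K > 0\<close> sqrt_series_sqrt_series[OF X X_le, of x]
      by (simp add: S_def linear_cmul[OF bounded_linear.linear[OF bl]] X_def[of x])
    show "U (S x) = S (U x)" if U: "bounded_linear U" and comm: "\<And>x. U (B x) = B (U x)" for U x
    proof -
      have "U (X x) = X (U x)" for x
        using comm by (simp add: X_def linear_diff linear_cmul bounded_linear.linear[OF U])
      from sqrt_series_commute[OF X X_le U this] show ?thesis
        by (simp add: S_def linear_cmul bounded_linear.linear[OF U])
    qed
  qed
qed

section \<open>Closed subspaces, distances, and operators determined by their forms\<close>

lemma subspace_closure:
  fixes M :: "'a::real_normed_vector set"
  assumes "subspace M"
  shows "subspace (closure M)"
proof (rule subspaceI)
  show "0 \<in> closure M" using subspace_0[OF assms] closure_subset by blast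
  show "x + y \<in> closure M" if "x \<in> closure M" "y \<in> closure M" for x y
  proof -
    obtain u where u: "\<And>n. u n \<in> M" "u \<longlonglongrightarrow> x" using \<open>x \<in> closure M\<close> unfolding closure_sequential by blast
    obtain v where v: "\<And>n. v n \<in> M" "v \<longlonglongrightarrow> y" using \<open>y \<in> closure M\<close> unfolding closure_sequential by blast
    have "\<And>n. u n + v n \<in> M" using u(1) v(1) by (intro subspace_add[OF assms])
    moreover have "(\<lambda>n. u n + v n) \<longlonglongrightarrow> x + y" using u(2) v(2) by (rule tendsto_add)
    ultimately show ?thesis unfolding closure_sequential by (intro exI[of _ "\<lambda>n. u n + v n"]) simp
  qed
  show "c *\<^sub>R x \<in> closure M" if "x \<in> closure M" for c x
  proof -
    have "c *\<^sub>R x \<in> closure ((*\<^sub>R) c ` M)"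
      using that closure_bounded_linear_image_subset[OF bounded_linear_scaleR_right[of c], of M] by blast
    moreover have "(*\<^sub>R) c ` M \<subseteq> M" using subspace_mul[OF assms] by auto
    ultimately show ?thesis using closure_mono by blast
  qed
qed

text \<open>Skewness moves \<open>U\<close> from the residual onto \<open>m\<close>, and invariance
  keeps \<open>U m\<close> in \<open>M\<close>, so \<open>U\<close> maps residuals to vectors
  orthogonal to \<open>M\<close>.\<close>

lemma proj_commute:
  assumes M: "subspace M" "closed M" and inv: "\<And>x. x \<in> M \<Longrightarrow> U x \<in> M"
    and skew: "\<And>x y. inner (U x) y = - inner x (U y)"
  shows "proj M (U x) = U (proj M x)"
proof (rule proj_unique[OF M])
  show "U (proj M x) \<in> M" by (intro inv proj_in[OF M])
  show "inner (U x - U (proj M x)) m = 0" if "m \<in> M" for m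
    using proj_orth[OF M inv[OF that], of x] by (simp add: inner_diff_left skew)
qed

text \<open>The range of \<open>J\<close> need not contain the nearest point
  \<open>proj M v\<close>; continuity of the distance makes the infimum over the range agree with
  the minimum over its closure.\<close>

lemma INF_dist_closure:
  fixes J :: "'b::real_vector \<Rightarrow> 'a::{real_inner,complete_space}"
  assumes "linear J" and M: "M = closure (range J)"
  shows "(INF y. (norm (v - J y))\<^sup>2) = (norm (v - proj M v))\<^sup>2"
proof -
  have sub: "subspace M" "closed M"
    using subspace_closure linear_subspace_image[OF assms(1) subspace_UNIV] by (auto simp: M)
  note in_M = proj_in[OF sub]
  have Pyth: "(norm (v - m))\<^sup>2 = (norm (v - proj M v))\<^sup>2 + (norm (proj M v - m))\<^sup>2" if "m \<in> M" for m
  proof -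
    have "proj M (v - m) = proj M v - m"
      using proj_linear[OF sub] proj_id[OF sub that] by (simp add: linear_diff)
    then show ?thesis using norm_proj_Pythagoras[OF sub, of "v - m"] by simp
  qed
  have J_M: "J y \<in> M" for y unfolding M using closure_subset[of "range J"] by blast
  show ?thesis
  proof (rule cInf_eq_non_empty)
    show "range (\<lambda>y. (norm (v - J y))\<^sup>2) \<noteq> {}" by simp
    show "(norm (v - proj M v))\<^sup>2 \<le> r" if "r \<in> range (\<lambda>y. (norm (v - J y))\<^sup>2)" for r
      using that Pyth[OF J_M] by auto
    show "r \<le> (norm (v - proj M v))\<^sup>2"
      if "\<And>s. s \<in> range (\<lambda>y. (norm (v - J y))\<^sup>2) \<Longrightarrow> r \<le> s" for r
    proof -
      have "closed {m. r \<le> (norm (v - m))\<^sup>2}" by (intro closed_Collect_le continuous_intros)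
      moreover have "range J \<subseteq> {m. r \<le> (norm (v - m))\<^sup>2}" using that by auto
      ultimately have "M \<subseteq> {m. r \<le> (norm (v - m))\<^sup>2}" unfolding M by (rule closure_minimal[rotated])
      then show ?thesis using in_M by auto
    qed
  qed
qed

text \<open>Polarisation. This is the uniqueness behind the definite description in
  \<open>parallel_sum\<close>.\<close>

lemma psd_eqI:
  assumes "psd A" "psd B" and eq: "\<And>x. inner (A x) x = inner (B x) x"
  shows "A = B"
proof
  fix x
  note lin = linear_add[OF psdD(2)[OF assms(1)]] linear_add[OF psdD(2)[OF assms(2)]]
  have "inner (A x) y = inner (B x) y" for y
    using eq[of "x + y"] eq[of x] eq[of y] psdD(3)[OF assms(1), of y x] psdD(3)[OF assms(2), of y x]
    by (simp add: lin algebra_simps inner_commute[of y])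
  then show "A x = B x" using inner_eq_zero_iff[of "A x - B x"] by (simp add: inner_diff_left)
qed

section \<open>Parallel sums\<close>

abbreviation mul_i :: "'a::complex_hilbert_space \<Rightarrow> 'a"
  where "mul_i \<equiv> scaleC \<i>"

lemma cinner_scaleC_right: "cinner x (scaleC c y) = cnj c * cinner x (y :: 'a::complex_hilbert_space)"
  by (metis cinner_commute cinner_scaleC_left complex_cnj_mult)

lemma Im_cinner: "Im (cinner x y) = inner x (mul_i (y :: 'a::complex_hilbert_space))"
  by (simp add: inner_eq_Re_cinner cinner_scaleC_right)

lemma scaleC_Re_Im: "scaleC c x = Re c *\<^sub>R x + Im c *\<^sub>R mul_i (x :: 'a::complex_hilbert_space)"
proof -
  have "scaleC (complex_of_real (Re c) + complex_of_real (Im c) * \<i>) x = Re c *\<^sub>R x + Im c *\<^sub>R mul_i x"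
    unfolding scaleC_add_left scaleR_scaleC scaleC_scaleC ..
  then show ?thesis by (simp add: mult.commute[of "complex_of_real (Im c)"] complex_eq[symmetric])
qed

lemma mul_i_mul_i: "mul_i (mul_i x) = - (x :: 'a::complex_hilbert_space)"
  using scaleR_scaleC[of "-1" x] by (simp add: scaleC_scaleC)

lemma mul_i_skew: "inner (mul_i x) y = - inner x (mul_i (y :: 'a::complex_hilbert_space))"
  by (simp add: inner_eq_Re_cinner cinner_scaleC_right cinner_scaleC_left)

lemma mul_i_isometry: "inner (mul_i x) (mul_i y) = inner x (y :: 'a::complex_hilbert_space)"
  by (simp add: mul_i_skew mul_i_mul_i)

lemma bounded_linear_mul_i: "bounded_linear (mul_i :: 'a::complex_hilbert_space \<Rightarrow> 'a)"
proof (rule bounded_linear_intro)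
  show "mul_i (x + y) = mul_i x + mul_i y" for x y :: 'a by (rule scaleC_add_right)
  show "mul_i (r *\<^sub>R x) = r *\<^sub>R mul_i x" for r and x :: 'a
    by (simp add: scaleR_scaleC scaleC_scaleC mult.commute)
  show "norm (mul_i x) \<le> norm x * 1" for x :: 'a by (simp add: norm_eq_sqrt_inner mul_i_isometry)
qed

lemma bounded_clinear_iff:
  "bounded_clinear A \<longleftrightarrow> bounded_linear A \<and> (\<forall>x. A (mul_i x) = mul_i (A x))"
proof
  assume A: "bounded_linear A \<and> (\<forall>x. A (mul_i x) = mul_i (A x))"
  then have "linear A" using bounded_linear.linear by blast
  then have "A (scaleC c x) = scaleC c (A x)" for c x
    using A by (simp add: scaleC_Re_Im[of c] linear_add linear_cmul)
  then show "bounded_clinear A" using A by (simp add: bounded_clinear_def)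
qed (simp add: bounded_clinear_def)

text \<open>Forwards, the imaginary part of the form vanishes; polarising it and replacing
  \<open>y\<close> by \<open>mul_i y\<close> gives symmetry. Backwards, symmetry and skewness of
  \<open>mul_i\<close> make that imaginary part equal to its own negative.\<close>

lemma positive_op_iff:
  "positive_op A \<longleftrightarrow> psd A \<and> (\<forall>x. A (mul_i x) = mul_i (A x))"
proof
  assume A: "positive_op A"
  then have bl: "bounded_linear A" and i: "\<And>x. A (mul_i x) = mul_i (A x)"
    by (auto simp: positive_op_def bounded_clinear_iff)
  note lin = bounded_linear.linear[OF bl]
  have nonneg: "cinner (A x) x \<in> \<real>\<^sub>\<ge>\<^sub>0" for x using A by (simp add: positive_op_def)
  have re: "0 \<le> inner (A x) x" for x
    using nonneg[of x] by (simp add: complex_nonneg_Reals_iff inner_eq_Re_cinner)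
  have im: "inner (A x) (mul_i x) = 0" for x
    using nonneg[of x] by (simp add: complex_nonneg_Reals_iff Im_cinner)
  have pol: "inner (A x) (mul_i y) + inner (A y) (mul_i x) = 0" for x y
    using im[of "x + y"] im[of x] im[of y]
    by (simp add: linear_add[OF lin] scaleC_add_right inner_add_left inner_add_right)
  have "inner (A x) y = inner x (A y)" for x y
    using pol[of x "mul_i y"] by (simp add: mul_i_mul_i i mul_i_isometry inner_commute)
  then show "psd A \<and> (\<forall>x. A (mul_i x) = mul_i (A x))" using bl re i by (simp add: psd_def)
next
  assume A: "psd A \<and> (\<forall>x. A (mul_i x) = mul_i (A x))"
  have "inner (A x) (mul_i x) = 0" for x
  proof -
    have "inner (A x) (mul_i x) = inner x (mul_i (A x))" using A by (simp add: psdD(3)[of A x])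
    also have "\<dots> = - inner (A x) (mul_i x)" using mul_i_skew[of x "A x"] by (simp add: inner_commute)
    finally show ?thesis by simp
  qed
  then show "positive_op A"
    using A by (auto simp: positive_op_def bounded_clinear_iff psd_def complex_nonneg_Reals_iff
        Im_cinner inner_eq_Re_cinner[symmetric])
qed

lemma positive_opD:
  assumes "positive_op A"
  shows "psd A" "A (mul_i x) = mul_i (A x)"
  using assms by (auto simp: positive_op_iff)

lemma positive_op_scaleR: "positive_op A \<Longrightarrow> 0 \<le> r \<Longrightarrow> positive_op (\<lambda>x. r *\<^sub>R A x)"
  unfolding positive_op_iff psd_def
  by (safe intro!: bounded_linear_const_scaleR)
    (simp_all add: linear_cmul[OF bounded_linear.linear[OF bounded_linear_mul_i]] del: inner_commute)

lemma op_le_iff: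
  assumes "positive_op A" "positive_op B"
  shows "op_le A B \<longleftrightarrow> (\<forall>x. inner (A x) x \<le> inner (B x) x)"
  using assms
  by (simp add: op_le_def positive_op_iff psd_def bounded_linear_sub inner_diff_left inner_diff_right
      linear_diff[OF bounded_linear.linear[OF bounded_linear_mul_i]])

lemma cinner_positive_op:
  assumes "positive_op A"
  shows "cinner (A x) x = complex_of_real r \<longleftrightarrow> inner (A x) x = r"
  using assms by (auto simp: positive_op_def complex_nonneg_Reals_iff inner_eq_Re_cinner complex_eq_iff)

section \<open>Existence and uniqueness of the parallel sum\<close>

lemma parallel_sum_eqI:
  assumes C: "positive_op C"
    and form: "\<And>x. inner (C x) x = (INF y. inner (A (x - y)) (x - y) + inner (B y) y)"
  shows "parallel_sum A B = C"
  unfolding parallel_sum_def inner_eq_Re_cinner[symmetric]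
proof (rule the_equality)
  show "positive_op C \<and> (\<forall>x. cinner (C x) x =
      complex_of_real (INF y. inner (A (x - y)) (x - y) + inner (B y) y))"
    using C by (simp add: cinner_positive_op form)
  show "D = C" if "positive_op D \<and> (\<forall>x. cinner (D x) x =
      complex_of_real (INF y. inner (A (x - y)) (x - y) + inner (B y) y))" for D
    using that by (intro psd_eqI) (auto simp: cinner_positive_op form positive_opD C)
qed

lemma positive_op_sqrt:
  assumes "positive_op B"
  obtains S where "bounded_linear S" "\<And>x y. inner (S x) y = inner x (S y)" "\<And>x. S (S x) = B x"
    "\<And>x. S (mul_i x) = mul_i (S x)"
proof -
  obtain S where "bounded_linear S" "\<And>x y. inner (S x) y = inner x (S y)" "\<And>x. S (S x) = B x"
    "\<And>U x. bounded_linear U \<Longrightarrow> (\<And>x. U (B x) = B (U x)) \<Longrightarrow> U (S x) = S (U x)"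
    using psd_sqrt[OF positive_opD(1)[OF assms]] by blast
  with that bounded_linear_mul_i positive_opD(2)[OF assms] show ?thesis by metis
qed

lemma parallel_sum_exists:
  assumes A: "positive_op A" and B: "positive_op B"
  shows "\<exists>C. positive_op C \<and>
    (\<forall>x. inner (C x) x = (INF y. inner (A (x - y)) (x - y) + inner (B y) y))"
proof -
  obtain S where S: "bounded_linear S" "\<And>x y. inner (S x) y = inner x (S y)" "\<And>x. S (S x) = A x"
    "\<And>x. S (mul_i x) = mul_i (S x)" using positive_op_sqrt[OF A] by blast
  obtain R where R: "bounded_linear R" "\<And>x y. inner (R x) y = inner x (R y)" "\<And>x. R (R x) = B x"
    "\<And>x. R (mul_i x) = mul_i (R x)" using positive_op_sqrt[OF B] by blast
  \<comment> \<open>The form is the squared distance of \<open>(S x, 0)\<close> from the range of \<open>J\<close>.\<close>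
  define J where "J y = (S y, R y)" for y
  define M where "M = closure (range J)"
  \<comment> \<open>\<open>U\<close> is multiplication by the imaginary unit on pairs; the product
    is treated as a real inner product space only.\<close>
  define U where "U = (\<lambda>(a, b). (mul_i a, mul_i b) :: 'a \<times> 'a)"
  have J: "bounded_linear J" unfolding J_def by (intro bounded_linear_Pair S R)
  note linJ = bounded_linear.linear[OF J]
  have sub: "subspace M" "closed M"
    using subspace_closure linear_subspace_image[OF linJ subspace_UNIV] by (auto simp: M_def)
  have U: "bounded_linear U"
    unfolding U_def case_prod_beta
    by (intro bounded_linear_Pair bounded_linear_compose[OF bounded_linear_mul_i] bounded_linear_fst bounded_linear_snd)
  have UM: "U m \<in> M" if "m \<in> M" for m
  proof -
    have "U ` M \<subseteq> closure (U ` range J)"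
      unfolding M_def by (rule closure_bounded_linear_image_subset[OF U])
    moreover have "U ` range J \<subseteq> range J" by (auto simp: U_def J_def S(4)[symmetric] R(4)[symmetric])
    ultimately show ?thesis using that closure_mono unfolding M_def by blast
  qed
  have skew: "inner (U a) b = - inner a (U b)" for a b
    by (cases a, cases b) (simp add: U_def mul_i_skew)
  define p where "p x = proj M (S x, 0)" for x
  have linP: "bounded_linear p"
    unfolding p_def
    by (intro bounded_linear_compose[OF proj_bounded_linear[OF sub]] bounded_linear_Pair S bounded_linear_zero)
  \<comment> \<open>Chosen so that pairing \<open>C x\<close> with \<open>y\<close> is pairing the
    residual of \<open>(S x, 0)\<close> with \<open>(S y, 0)\<close>; for \<open>y = x\<close> this
    is the squared distance to \<open>M\<close>.\<close>
  define C where "C x = S (S x - fst (p x))" for x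
  have "bounded_linear C"
    unfolding C_def
    by (intro bounded_linear_compose[OF S(1)] bounded_linear_sub S(1) bounded_linear_compose[OF bounded_linear_fst linP])
  have C_inner: "inner (C x) y = inner ((S x, 0) - p x) (S y, 0)" for x y
    by (cases "p x") (simp add: C_def S(2))
  have C_inner': "inner (C x) y = inner (S x) (S y) - inner (p x) (p y)" for x y
    using inner_proj[OF sub, of "(S x, 0)" "(S y, 0)"] by (simp add: C_inner inner_diff_left p_def)
  have form: "inner (C x) x = (INF y. inner (A (x - y)) (x - y) + inner (B y) y)" for x
  proof -
    have "inner (C x) x = (norm ((S x, 0) - p x))\<^sup>2"
      using norm_proj_Pythagoras[OF sub, of "(S x, 0)"]
      by (simp add: C_inner' p_def power2_norm_eq_inner norm_Pair)
    also have "\<dots> = (INF y. (norm ((S x, 0) - J y))\<^sup>2)"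
      unfolding p_def by (rule INF_dist_closure[OF linJ M_def, symmetric])
    also have "\<dots> = (INF y. inner (A (x - y)) (x - y) + inner (B y) y)"
    proof -
      have "(norm ((S x, 0) - J y))\<^sup>2 = inner (A (x - y)) (x - y) + inner (B y) y" for y
      proof -
        have "(norm ((S x, 0) - J y))\<^sup>2 = (norm (S (x - y)))\<^sup>2 + (norm (R y))\<^sup>2"
          by (simp add: J_def norm_Pair linear_diff[OF bounded_linear.linear[OF S(1)]])
        also have "\<dots> = inner (S (S (x - y))) (x - y) + inner (R (R y)) y"
          using S(2)[of "S (x - y)" "x - y"] R(2)[of "R y" y] by (simp only: power2_norm_eq_inner)
        finally show ?thesis by (simp only: S(3) R(3))
      qed
      then show ?thesis by simp
    qed
    finally show ?thesis .
  qed
  have "positive_op C"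
    unfolding positive_op_iff psd_def
  proof (intro conjI allI)
    show "bounded_linear C" by fact
    show "inner (C x) y = inner x (C y)" for x y
      using C_inner'[of x y] C_inner'[of y x] by (simp add: inner_commute)
    have "norm (p x) \<le> norm (S x)" for x
      using norm_proj_le[OF sub, of "(S x, 0)"] by (simp add: p_def norm_Pair)
    then have "(norm (p x))\<^sup>2 \<le> (norm (S x))\<^sup>2" for x by (rule power_mono) simp
    then show "0 \<le> inner (C x) x" for x by (simp add: C_inner' power2_norm_eq_inner)
    show "C (mul_i x) = mul_i (C x)" for x
    proof -
      have "p (mul_i x) = U (p x)"
      proof -
        have "mul_i (0::'a) = 0" by (rule linear_0[OF bounded_linear.linear[OF bounded_linear_mul_i]])
        then show ?thesis
          using proj_commute[OF sub UM skew, of "(S x, 0)"] by (simp add: p_def U_def S(4))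
      qed
      then have "fst (p (mul_i x)) = mul_i (fst (p x))" by (simp add: U_def case_prod_beta)
      then show ?thesis
        by (simp add: C_def S(4) linear_diff[OF bounded_linear.linear[OF bounded_linear_mul_i], symmetric])
    qed
  qed
  with form show ?thesis by blast
qed

lemma parallel_sum_positive:
  assumes A: "positive_op A" and B: "positive_op B"
  shows "positive_op (parallel_sum A B)"
    and "inner (parallel_sum A B x) x = (INF y. inner (A (x - y)) (x - y) + inner (B y) y)"
proof -
  obtain C where "positive_op C"
    and form: "\<And>x. inner (C x) x = (INF y. inner (A (x - y)) (x - y) + inner (B y) y)"
    using parallel_sum_exists[OF assms] by blast
  moreover have "parallel_sum A B = C" by (rule parallel_sum_eqI) fact+
  ultimately show "positive_op (parallel_sum A B)"
    and "inner (parallel_sum A B x) x = (INF y. inner (A (x - y)) (x - y) + inner (B y) y)" by simp_all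
qed

section \<open>Quasi-units\<close>

text \<open>The differences \<open>C n - C m\<close> are positive with uniformly bounded forms, so
  \<open>psd_norm_square_le\<close> bounds their norms at \<open>x\<close> by increments of a
  bounded monotone real sequence.\<close>

lemma psd_incseq_convergent:
  fixes C :: "nat \<Rightarrow> 'a::{real_inner,complete_space} \<Rightarrow> 'a"
  assumes C: "\<And>n. psd (C n)"
    and mono: "\<And>m n x. m \<le> n \<Longrightarrow> inner (C m x) x \<le> inner (C n x) x"
    and bound: "\<And>n x. inner (C n x) x \<le> K * (norm x)\<^sup>2"
  shows "convergent (\<lambda>n. C n x)"
proof -
  define f where "f n = inner (C n x) x" for n
  \<comment> \<open>\<open>K\<close> may be zero or negative; \<open>\<bar>K\<bar> + 1\<close> is a
    positive constant by which one can divide.\<close>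
  have K_le: "K * t \<le> (\<bar>K\<bar> + 1) * t" if "0 \<le> t" for t
    using that by (intro mult_right_mono) auto
  have diff: "(norm (C n x - C m x))\<^sup>2 \<le> (\<bar>K\<bar> + 1) * (f n - f m)" if "m \<le> n" for m n
  proof -
    have "psd (\<lambda>x. C n x - C m x)"
      using C mono[OF that] by (simp add: psd_def bounded_linear_sub inner_diff_left inner_diff_right)
    moreover have "inner (C n x - C m x) x \<le> (\<bar>K\<bar> + 1) * (norm x)\<^sup>2" for x
      using bound[of n x] psdD(4)[OF C, of m x] K_le[of "(norm x)\<^sup>2"] by (simp add: inner_diff_left)
    ultimately have "(norm (C n x - C m x))\<^sup>2 \<le> (\<bar>K\<bar> + 1) * inner (C n x - C m x) x"
      by (rule psd_norm_square_le)
    then show ?thesis by (simp add: f_def inner_diff_left)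
  qed
  have "incseq f" unfolding f_def by (simp add: incseq_def mono)
  then obtain L where L: "f \<longlonglongrightarrow> L" "\<And>n. f n \<le> L"
    using incseq_convergent[of f "K * (norm x)\<^sup>2"] bound f_def by auto
  have "Cauchy (\<lambda>n. C n x)"
  proof (rule CauchyI')
    fix e :: real assume "0 < e"
    then have "\<forall>\<^sub>F n in sequentially. L - e\<^sup>2 / (\<bar>K\<bar> + 1) < f n"
      by (intro order_tendstoD[OF L(1)]) (simp add: add_nonneg_pos)
    then obtain N where N: "\<And>n. n \<ge> N \<Longrightarrow> L - e\<^sup>2 / (\<bar>K\<bar> + 1) < f n"
      unfolding eventually_sequentially by blast
    have "norm (C m x - C n x) < e" if "N \<le> m" "m < n" for m n
    proof -
      have "f n - f m < e\<^sup>2 / (\<bar>K\<bar> + 1)" using N[OF that(1)] L(2)[of n] by linarith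
      then have "(\<bar>K\<bar> + 1) * (f n - f m) < e\<^sup>2" by (simp add: field_simps add_pos_nonneg)
      then have "(norm (C m x - C n x))\<^sup>2 < e\<^sup>2"
        using diff[of m n] that by (simp add: norm_minus_commute)
      then show ?thesis using \<open>0 < e\<close> by (rule power2_less_imp_less[OF _ less_imp_le])
    qed
    then show "\<exists>M. \<forall>m\<ge>M. \<forall>n>m. dist (C m x) (C n x) < e" unfolding dist_norm by blast
  qed
  then show ?thesis by (rule Cauchy_convergent)
qed

lemma psd_form_bound:
  assumes "psd B"
  obtains K where "\<And>x. inner (B x) x \<le> K * (norm x)\<^sup>2"
proof -
  obtain K where K: "\<And>x. norm (B x) \<le> norm x * K"
    using bounded_linear.bounded[OF psdD(1)[OF assms]] by blast
  have "inner (B x) x \<le> K * (norm x)\<^sup>2" for x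
    using order_trans[OF norm_cauchy_schwarz mult_right_mono[OF K norm_ge_zero], of x x]
    by (simp add: power2_eq_square mult_ac)
  then show ?thesis by (rule that)
qed

text \<open>An increasing convergent sequence stays below its limit; convergence must come first, as
  \<open>lim\<close> is otherwise arbitrary. For a quasi-unit the right-hand side is the form of
  \<open>A\<close>, which gives an estimate for every \<open>n\<close>.\<close>

lemma generalized_short_form_ge:
  assumes A: "positive_op A" and B: "positive_op B"
  shows "(INF y. inner (B (x - y)) (x - y) + real n * inner (A y) y) \<le> inner (generalized_short A B x) x"
proof -
  define q where "q n x y = inner (B (x - y)) (x - y) + real n * inner (A y) y" for n x y
  define C where "C n = parallel_sum B (\<lambda>z. real n *\<^sub>R A z)" for n
  have nA: "positive_op (\<lambda>z. real n *\<^sub>R A z)" for n by (rule positive_op_scaleR[OF A]) simp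
  have C: "positive_op (C n)" for n
    unfolding C_def by (rule parallel_sum_positive[OF B nA])
  have form: "inner (C n x) x = (INF y. q n x y)" for n x
    unfolding C_def parallel_sum_positive(2)[OF B nA] q_def by simp
  note A0 = psdD(4)[OF positive_opD(1)[OF A]] and B0 = psdD(4)[OF positive_opD(1)[OF B]]
  have bdd: "bdd_below (range (q n x))" for n x
    using A0 B0 by (intro bdd_belowI[of _ 0]) (auto simp: q_def)
  have mono: "inner (C m x) x \<le> inner (C n x) x" if "m \<le> n" for m n x
    unfolding form
  proof (rule cINF_mono)
    show "\<exists>y'\<in>UNIV. q m x y' \<le> q n x y" for y
      using that A0 by (intro bexI[of _ y]) (auto simp: q_def intro!: mult_right_mono)
  qed (simp_all add: bdd)
  obtain K where K: "\<And>x. inner (B x) x \<le> K * (norm x)\<^sup>2"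
    using psd_form_bound[OF positive_opD(1)[OF B]] by blast
  have "inner (C n x) x \<le> K * (norm x)\<^sup>2" for n x
  proof -
    have "inner (C n x) x \<le> q n x 0" unfolding form by (rule cINF_lower[OF bdd]) simp
    also have "\<dots> \<le> K * (norm x)\<^sup>2" using K[of x] by (simp add: q_def)
    finally show ?thesis .
  qed
  then have "convergent (\<lambda>n. C n x)"
    using positive_opD(1)[OF C] mono by (intro psd_incseq_convergent)
  then have "(\<lambda>n. C n x) \<longlonglongrightarrow> generalized_short A B x"
    unfolding generalized_short_def C_def by (simp add: convergent_LIMSEQ_iff)
  then have "(\<lambda>n. inner (C n x) x) \<longlonglongrightarrow> inner (generalized_short A B x) x"
    by (intro tendsto_intros)
  then have "inner (C n x) x \<le> inner (generalized_short A B x) x"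
    by (rule incseq_le[rotated]) (simp add: incseq_def mono)
  then show ?thesis unfolding form q_def .
qed

text \<open>A real subspace stable under \<open>mul_i\<close> is a complex one, by
  \<open>scaleC_Re_Im\<close>.\<close>

definition closed_csubspace :: "'a::complex_hilbert_space set \<Rightarrow> bool"
  where "closed_csubspace M \<longleftrightarrow> subspace M \<and> closed M \<and> (\<forall>x\<in>M. mul_i x \<in> M)"

lemma closed_csubspaceD:
  assumes "closed_csubspace M"
  shows "subspace M" "closed M" "x \<in> M \<Longrightarrow> mul_i x \<in> M"
  using assms by (auto simp: closed_csubspace_def)

lemma closed_csubspace_closure_range:
  assumes z: "linear z" and i: "\<And>x. z (mul_i x) = mul_i (z x)"
  shows "closed_csubspace (closure (range z))"
  unfolding closed_csubspace_def
proof (intro conjI ballI)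
  show "subspace (closure (range z))"
    by (intro subspace_closure linear_subspace_image[OF z] subspace_UNIV)
  show "mul_i x \<in> closure (range z)" if "x \<in> closure (range z)" for x
  proof -
    have "mul_i x \<in> closure (mul_i ` range z)"
      using that closure_bounded_linear_image_subset[OF bounded_linear_mul_i, of "range z"] by blast
    moreover have "mul_i ` range z \<subseteq> range z" by (auto simp: i[symmetric])
    ultimately show ?thesis using closure_mono by blast
  qed
qed simp

lemma closed_csubspace_Inter:
  "(\<And>M. M \<in> \<M> \<Longrightarrow> closed_csubspace M) \<Longrightarrow> closed_csubspace (\<Inter>\<M>)"
  unfolding closed_csubspace_def by (auto intro: subspace_Inter)

section \<open>Compressions of projections by a square root \<open>S\<close> of
  \<open>B\<close>\<close>

context
  fixes B S :: "'a::complex_hilbert_space \<Rightarrow> 'a"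
  assumes S: "bounded_linear S" and S_sym: "\<And>x y. inner (S x) y = inner x (S y)"
    and S_S: "\<And>x. S (S x) = B x" and S_i: "\<And>x. S (mul_i x) = mul_i (S x)"
begin

definition compress :: "'a set \<Rightarrow> 'a \<Rightarrow> 'a"
  where "compress M x = S (proj M (S x))"

lemma B_form: "inner (B x) x = (norm (S x))\<^sup>2"
  by (simp add: S_S[symmetric] S_sym power2_norm_eq_inner)

lemma positive_op_B: "positive_op B"
proof -
  have "B = (\<lambda>x. S (S x))" using S_S by auto
  then have "bounded_linear B" using bounded_linear_compose[OF S S] by simp
  then show ?thesis
    unfolding positive_op_iff psd_def by (simp add: B_form) (simp add: S_S[symmetric] S_sym S_i)
qed

context
  fixes M :: "'a set"
  assumes M: "closed_csubspace M"
begin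

lemma compress_inner: "inner (compress M x) y = inner (proj M (S x)) (proj M (S y))"
  unfolding compress_def S_sym by (rule inner_proj[OF closed_csubspaceD(1,2)[OF M]])

lemma compress_form: "inner (compress M x) x = (norm (proj M (S x)))\<^sup>2"
  by (simp add: compress_inner power2_norm_eq_inner)

lemma positive_op_compress: "positive_op (compress M)"
  unfolding positive_op_iff psd_def
proof (intro conjI allI)
  show "bounded_linear (compress M)"
    unfolding compress_def
    by (intro bounded_linear_compose[OF S] bounded_linear_compose[OF proj_bounded_linear] S
        closed_csubspaceD[OF M])
  show "inner (compress M x) y = inner x (compress M y)" for x y
    using compress_inner[of x y] compress_inner[of y x] by (simp add: inner_commute)
  show "0 \<le> inner (compress M x) x" for x by (simp add: compress_form)
  show "compress M (mul_i x) = mul_i (compress M x)" for x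
    using proj_commute[where U = mul_i and x = "S x", OF closed_csubspaceD[OF M] mul_i_skew]
    by (simp add: compress_def S_i)
qed

lemma compress_le: "op_le (compress M) B"
  using norm_proj_le[OF closed_csubspaceD(1,2)[OF M]]
  by (simp add: op_le_iff positive_op_compress positive_op_B compress_form B_form power_mono)

text \<open>With \<open>v = S y\<close> the functional becomes \<open>g v\<close>. The part of
  \<open>v\<close> orthogonal to \<open>M\<close> can match that of \<open>S x\<close> at no cost,
  and inside \<open>M\<close> one minimises
  \<open>(norm (p - b))\<^sup>2 + real n * (norm b)\<^sup>2\<close>, attained at
  \<open>b = p / (n + 1)\<close>.\<close>

lemma parallel_sum_compress:
  assumes M_le: "M \<subseteq> closure (range S)"
  shows "parallel_sum B (\<lambda>z. real n *\<^sub>R compress M z) = (\<lambda>x. (real n / (real n + 1)) *\<^sub>R compress M x)"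
proof (rule parallel_sum_eqI)
  show "positive_op (\<lambda>x. (real n / (real n + 1)) *\<^sub>R compress M x)"
    by (rule positive_op_scaleR[OF positive_op_compress]) simp
  fix x
  note sub = closed_csubspaceD(1,2)[OF M]
  note linP = linear_add[OF proj_linear[OF sub]] linear_diff[OF proj_linear[OF sub]]
    linear_cmul[OF proj_linear[OF sub]]
  define g where "g v = (norm (S x - v))\<^sup>2 + real n * (norm (proj M v))\<^sup>2" for v
  define p where "p = proj M (S x)"
  define c where "c = real n / (real n + 1) * (norm p)\<^sup>2"
  have "inner (B (x - y)) (x - y) + inner (real n *\<^sub>R compress M y) y = g (S y)" for y
    by (simp add: B_form compress_form g_def linear_diff[OF bounded_linear.linear[OF S]])
  moreover have "(INF y. g (S y)) = c"
  proof (rule cInf_eq_non_empty)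
    show "c \<le> r" if "r \<in> range (\<lambda>y. g (S y))" for r
    proof -
      obtain y where r: "r = g (S y)" using \<open>r \<in> range (\<lambda>y. g (S y))\<close> by blast
      define b where "b = proj M (S y)"
      \<comment> \<open>Completing the square around the optimal \<open>b\<close>; divided by
        \<open>n + 1\<close> this is the lower bound \<open>c\<close>.\<close>
      have "0 \<le> (norm (p - (real n + 1) *\<^sub>R b))\<^sup>2" by simp
      also have "\<dots> = (real n + 1) * ((norm (p - b))\<^sup>2 + real n * (norm b)\<^sup>2) - real n * (norm p)\<^sup>2"
        unfolding power2_norm_eq_inner by (simp add: algebra_simps inner_commute)
      finally have "c \<le> (norm (p - b))\<^sup>2 + real n * (norm b)\<^sup>2"
        by (simp add: c_def divide_le_eq mult.commute)
      also have "(norm (p - b))\<^sup>2 \<le> (norm (S x - S y))\<^sup>2"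
        using norm_proj_le[OF sub, of "S x - S y"] by (intro power_mono) (auto simp: p_def b_def linP)
      finally show ?thesis by (simp add: r g_def b_def)
    qed
    show "r \<le> c" if "\<And>s. s \<in> range (\<lambda>y. g (S y)) \<Longrightarrow> r \<le> s" for r
    proof -
      have "closed {v. r \<le> g v}"
        unfolding g_def
        by (intro closed_Collect_le continuous_intros
            linear_continuous_on[OF proj_bounded_linear[OF sub]])
      moreover have "range S \<subseteq> {v. r \<le> g v}" using that by auto
      ultimately have K: "closure (range S) \<subseteq> {v. r \<le> g v}" by (rule closure_minimal[rotated])
      \<comment> \<open>The minimiser: its projection to \<open>M\<close> is
        \<open>p / (n + 1)\<close>, and the rest agrees with that of \<open>S x\<close>. It lies
        only in the closure of the range of \<open>S\<close>, whence the passage to the closure in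
        \<open>K\<close> and the use of \<open>M_le\<close>.\<close>
      define v where "v = S x - (real n / (real n + 1)) *\<^sub>R p"
      have subK: "subspace (closure (range S))"
        using closed_csubspace_closure_range[OF bounded_linear.linear[OF S] S_i] closed_csubspaceD by blast
      have pM: "p \<in> M" unfolding p_def by (rule proj_in[OF sub])
      have "S x \<in> closure (range S)" using closure_subset[of "range S"] by blast
      then have "v \<in> closure (range S)"
        unfolding v_def using pM M_le by (intro subspace_diff[OF subK] subspace_mul[OF subK]) auto
      then have "r \<le> g v" using K by auto
      have "proj M v = (1 - real n / (real n + 1)) *\<^sub>R p"
        unfolding v_def linP proj_id[OF sub pM] p_def[symmetric] by (simp add: scaleR_diff_left)
      then have "g v = ((real n / (real n + 1))\<^sup>2 + real n * (1 - real n / (real n + 1))\<^sup>2) * (norm p)\<^sup>2"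
        unfolding g_def
        by (simp only: v_def diff_diff_eq2 add_diff_cancel_left' norm_scaleR power_mult_distrib power2_abs distrib_right mult.assoc)
      also have "(real n / (real n + 1))\<^sup>2 + real n * (1 - real n / (real n + 1))\<^sup>2 = real n / (real n + 1)"
      proof -
        have "((d - 1) / d)\<^sup>2 + (d - 1) * (1 - (d - 1) / d)\<^sup>2 = (d - 1) / d" if "d > 0" for d :: real
          using that by (simp add: field_simps power2_eq_square)
        from this[of "real n + 1"] show ?thesis by (simp only: add_diff_cancel_right')
      qed
      finally show ?thesis using \<open>r \<le> g v\<close> by (simp add: c_def)
    qed
  qed simp
  ultimately show "inner ((real n / (real n + 1)) *\<^sub>R compress M x) x =
      (INF y. inner (B (x - y)) (x - y) + inner (real n *\<^sub>R compress M y) y)"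
    by (simp add: compress_form c_def p_def)
qed

lemma compress_quasi_unit:
  assumes "M \<subseteq> closure (range S)"
  shows "compress M \<in> quasi_units B"
proof -
  have "(\<lambda>n. (real n / (real n + 1)) *\<^sub>R compress M x) \<longlonglongrightarrow> 1 *\<^sub>R compress M x" for x
    by (intro tendsto_intros LIMSEQ_n_over_Suc_n[unfolded of_nat_Suc add.commute[of 1]])
  then have "generalized_short (compress M) B x = compress M x" for x
    unfolding generalized_short_def parallel_sum_compress[OF assms] by (auto intro: limI)
  then show ?thesis using positive_op_compress compress_le by (auto simp: quasi_units_def)
qed

end

text \<open>The order compares norms of projections on the range of \<open>S\<close>, hence on its
  closure. For \<open>v\<close> in \<open>M\<close> it gives
  \<open>norm v \<le> norm (proj N v)\<close>, and Pythagoras puts \<open>v\<close> into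
  \<open>N\<close>. Conversely, inclusion means that projecting to \<open>N\<close> first does not
  change the projection to \<open>M\<close>.\<close>

lemma compress_le_iff:
  assumes M: "closed_csubspace M" and N: "closed_csubspace N" and M_le: "M \<subseteq> closure (range S)"
  shows "op_le (compress M) (compress N) \<longleftrightarrow> M \<subseteq> N"
proof -
  note subM = closed_csubspaceD(1,2)[OF M] and subN = closed_csubspaceD(1,2)[OF N]
  have le: "op_le (compress M) (compress N) \<longleftrightarrow> (\<forall>x. norm (proj M (S x)) \<le> norm (proj N (S x)))"
    by (simp add: op_le_iff positive_op_compress M N compress_form abs_le_square_iff[symmetric])
  show ?thesis
  proof
    assume "op_le (compress M) (compress N)"
    then have "range S \<subseteq> {v. norm (proj M v) \<le> norm (proj N v)}" by (auto simp: le)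
    moreover have "closed {v. norm (proj M v) \<le> norm (proj N v)}"
      by (intro closed_Collect_le continuous_intros linear_continuous_on proj_bounded_linear subM subN)
    ultimately have K: "closure (range S) \<subseteq> {v. norm (proj M v) \<le> norm (proj N v)}"
      by (rule closure_minimal)
    show "M \<subseteq> N"
    proof
      fix v assume "v \<in> M"
      then have "norm v \<le> norm (proj N v)" using K M_le proj_id[OF subM, of v] by auto
      then have "(norm v)\<^sup>2 \<le> (norm (proj N v))\<^sup>2" by (intro power_mono) auto
      then have "v - proj N v = 0" using norm_proj_Pythagoras[OF subN, of v] by simp
      then show "v \<in> N" using proj_in[OF subN, of v] by simp
    qed
  next
    assume "M \<subseteq> N"
    have "proj M v = proj M (proj N v)" for v
    proof (rule proj_unique[OF subM])
      show "proj M (proj N v) \<in> M" by (rule proj_in[OF subM])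
      show "inner (v - proj M (proj N v)) m = 0" if "m \<in> M" for m
        using proj_orth[OF subM that, of "proj N v"] proj_orth[OF subN, of m v] that \<open>M \<subseteq> N\<close>
        by (auto simp: inner_diff_left)
    qed
    then have "norm (proj M v) \<le> norm (proj N v)" for v
      using norm_proj_le[OF subM, of "proj N v"] by simp
    then show "op_le (compress M) (compress N)" by (simp add: le)
  qed
qed

lemma quasi_unit_eq_compress:
  assumes "A \<in> quasi_units B"
  obtains M where "closed_csubspace M" "M \<subseteq> closure (range S)" "A = compress M"
proof -
  have A: "positive_op A" and le: "op_le A B" and A_eq: "A = generalized_short A B"
    using assms by (auto simp: quasi_units_def)
  note psdA = positive_opD(1)[OF A]
  note linA = linear_add[OF psdD(2)[OF psdA]] linear_diff[OF psdD(2)[OF psdA]] linear_cmul[OF psdD(2)[OF psdA]]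
  note linS = linear_add[OF bounded_linear.linear[OF S]] linear_diff[OF bounded_linear.linear[OF S]]
    linear_cmul[OF bounded_linear.linear[OF S]]
  have form_le: "inner (A x) x \<le> (norm (S x))\<^sup>2" for x
    using le by (simp add: op_le_iff A positive_op_B B_form)
  \<comment> \<open>Cauchy-Schwarz for \<open>A\<close> together with \<open>A \<le> B\<close>
    bounds the functional by \<open>sqrt (inner (A x) x)\<close> times \<open>norm (S y)\<close>;
    keeping this sharp constant yields \<open>z_le\<close>.\<close>
  have "\<exists>t. t \<in> closure (range S) \<and> (\<forall>y. inner (A x) y = inner t (S y)) \<and> (norm t)\<^sup>2 \<le> inner (A x) x" for x
  proof (rule riesz_relative[of UNIV S "inner (A x)" "sqrt (inner (A x) x)"])
    show "linear (inner (A x))" by (rule bounded_linear.linear[OF bounded_linear_inner_right])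
    show "inner (A x) y \<le> sqrt (inner (A x) x) * norm (S y)" for y
    proof -
      have "(inner (A x) y)\<^sup>2 \<le> inner (A x) x * inner (A y) y" by (rule psd_Cauchy_Schwarz[OF psdA])
      also have "\<dots> \<le> inner (A x) x * (norm (S y))\<^sup>2"
        using form_le psdD(4)[OF psdA] by (intro mult_left_mono)
      finally have "\<bar>inner (A x) y\<bar> \<le> sqrt (inner (A x) x * (norm (S y))\<^sup>2)"
        using real_sqrt_le_mono by fastforce
      then show ?thesis by (simp add: real_sqrt_mult)
    qed
    show ?thesis if "t \<in> closure (S ` UNIV)" "\<And>y. y \<in> UNIV \<Longrightarrow> inner (A x) y = inner t (S y)"
        "norm t \<le> sqrt (inner (A x) x)" for t
    proof -
      have "(norm t)\<^sup>2 \<le> inner (A x) x"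
        using power_mono[OF that(3) norm_ge_zero, of 2] psdD(4)[OF psdA] by simp
      then show ?thesis using that by blast
    qed
  qed (use psdD(4)[OF psdA] bounded_linear.linear[OF S] in auto)
  then obtain z where z_cl: "\<And>x. z x \<in> closure (range S)"
    and z: "\<And>x y. inner (A x) y = inner (z x) (S y)"
    and z_le: "\<And>x. (norm (z x))\<^sup>2 \<le> inner (A x) x" by metis
  have csub: "closed_csubspace (closure (range S))"
    by (rule closed_csubspace_closure_range[OF bounded_linear.linear[OF S] S_i])
  note subK = closed_csubspaceD(1)[OF csub]
  \<comment> \<open>Linearity of \<open>z\<close> comes from uniqueness of the representing vector
    within the closure of the range of \<open>S\<close>.\<close>
  have z_add: "z (x + y) = z x + z y" for x y
    by (rule closure_eqI_inner[where V = "range S"])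
      (auto simp: z_cl subspace_add[OF subK] inner_add_left z[symmetric] linA)
  have z_cmul: "z (r *\<^sub>R x) = r *\<^sub>R z x" for r x
    by (rule closure_eqI_inner[where V = "range S"])
      (auto simp: z_cl subspace_mul[OF subK] z[symmetric] linA)
  have z_i: "z (mul_i x) = mul_i (z x)" for x
    by (rule closure_eqI_inner[where V = "range S"])
      (auto simp: z_cl closed_csubspaceD(3)[OF csub] mul_i_skew S_i[symmetric] z[symmetric] positive_opD(2)[OF A])
  have lin_z: "linear z" using z_add z_cmul by (rule linearI)
  \<comment> \<open>The quasi-unit equation enters here: the infimum for the factor \<open>k\<close>
    is at most \<open>a\<close>, yet at least
    \<open>2 * a - (norm (z x))\<^sup>2 - a * inverse k\<close>. The index \<open>Suc n\<close>
    keeps \<open>k\<close> positive, and \<open>k\<close> tends to infinity.\<close>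
  have z_ge: "inner (A x) x \<le> (norm (z x))\<^sup>2" for x
  proof -
    define a where "a = inner (A x) x"
    have "a - a * inverse (real (Suc n)) \<le> (norm (z x))\<^sup>2" for n
    proof -
      define k where "k = real (Suc n)"
      have "k > 0" by (simp add: k_def)
      have "2 * a - (norm (z x))\<^sup>2 - a * inverse k \<le> inner (B (x - y)) (x - y) + k * inner (A y) y" for y
      proof -
        \<comment> \<open>Two squares bound the two terms of the parallel sum from below. This one
          handles \<open>B\<close>; the cross term is rewritten through \<open>z\<close> as a value
          of the form of \<open>A\<close>.\<close>
        have "0 \<le> (norm (S (x - y) - z x))\<^sup>2" by simp
        also have "\<dots> = inner (B (x - y)) (x - y) - 2 * inner (z x) (S (x - y)) + (norm (z x))\<^sup>2"
          unfolding B_form power2_norm_eq_inner by (simp add: inner_diff_left inner_diff_right inner_commute)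
        finally have 1: "2 * (a - inner (A x) y) \<le> inner (B (x - y)) (x - y) + (norm (z x))\<^sup>2"
          by (simp add: z[symmetric] a_def inner_diff_right)
        \<comment> \<open>The second square handles \<open>k * inner (A y) y\<close>; the
          coefficients are chosen so that \<open>inner (A x) y\<close> cancels when both estimates
          are added.\<close>
        have "0 \<le> inverse k * inner (A (x - k *\<^sub>R y)) (x - k *\<^sub>R y)"
          using psdD(4)[OF psdA] \<open>k > 0\<close> by simp
        also have "\<dots> = a * inverse k - 2 * inner (A x) y + k * inner (A y) y"
        proof -
          have "inner (A y) x = inner (A x) y" using psdD(3)[OF psdA, of y x] by (simp add: inner_commute)
          then have "inner (A (x - k *\<^sub>R y)) (x - k *\<^sub>R y) = a - 2 * k * inner (A x) y + k * k * inner (A y) y"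
            by (simp add: linA a_def inner_diff_left inner_diff_right algebra_simps)
          then show ?thesis using \<open>k > 0\<close> by (simp add: field_simps)
        qed
        finally have "2 * inner (A x) y \<le> a * inverse k + k * inner (A y) y" by simp
        with 1 show ?thesis by argo
      qed
      then have "2 * a - (norm (z x))\<^sup>2 - a * inverse k \<le> (INF y. inner (B (x - y)) (x - y) + k * inner (A y) y)"
        by (intro cINF_greatest) auto
      also have "\<dots> \<le> a"
        using generalized_short_form_ge[OF A positive_op_B, of x "Suc n"] A_eq by (simp add: k_def a_def)
      finally show ?thesis by (simp add: k_def)
    qed
    moreover have "(\<lambda>n. a - a * inverse (real (Suc n))) \<longlonglongrightarrow> a - a * 0"
      by (intro tendsto_intros LIMSEQ_inverse_real_of_nat)
    ultimately have "a - a * 0 \<le> (norm (z x))\<^sup>2" by (intro LIMSEQ_le_const2) auto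
    then show ?thesis by (simp add: a_def)
  qed
  have z_form: "inner (z x) (z x) = inner (A x) x" for x
    using z_le[of x] z_ge[of x] by (simp add: power2_norm_eq_inner)
  have z_z: "inner (z x) (z y) = inner (A x) y" for x y
    using z_form[of "x + y"] z_form[of x] z_form[of y] psdD(3)[OF psdA, of y x]
    by (simp add: z_add linA inner_add_left inner_add_right inner_commute)
  define M where "M = closure (range z)"
  have M: "closed_csubspace M" unfolding M_def by (rule closed_csubspace_closure_range[OF lin_z z_i])
  \<comment> \<open>By symmetry of \<open>A\<close>, \<open>inner (S x) (z w)\<close> is
    \<open>inner (A x) w\<close>, which by \<open>z_z\<close> is also
    \<open>inner (z x) (z w)\<close>; so the residual \<open>S x - z x\<close> is orthogonal to the
    range of \<open>z\<close>.\<close>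
  have proj_M: "proj M (S x) = z x" for x
  proof (rule proj_unique[OF closed_csubspaceD(1,2)[OF M]])
    show "z x \<in> M" unfolding M_def using closure_subset[of "range z"] by blast
    have "inner (S x) (z w) = inner (A x) w" for w
      using z[of w x] psdD(3)[OF psdA, of w x] by (simp add: inner_commute)
    then have "inner (S x - z x) (z w) = 0" for w by (simp add: inner_diff_left z_z)
    then have "range z \<subseteq> {m. inner (S x - z x) m = 0}" by auto
    moreover have "closed {m. inner (S x - z x) m = 0}" by (intro closed_Collect_eq continuous_intros)
    ultimately have "M \<subseteq> {m. inner (S x - z x) m = 0}" unfolding M_def by (rule closure_minimal)
    then show "inner (S x - z x) m = 0" if "m \<in> M" for m using that by auto
  qed
  have "A x = compress M x" for x
  proof -
    have "inner (A x - compress M x) y = 0" for y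
      by (simp add: inner_diff_left compress_def proj_M S_sym z)
    then show ?thesis using inner_eq_zero_iff[of "A x - compress M x"] by simp
  qed
  moreover have "M \<subseteq> closure (range S)"
    unfolding M_def using z_cl by (intro closure_minimal) auto
  ultimately show ?thesis using M by (intro that) auto
qed

end

theorem corollary6:
  fixes B :: "'a::complex_hilbert_space \<Rightarrow> 'a"
  assumes "positive_op B"
  shows "lattice (quasi_unit_order B)"
proof -
  obtain S where S: "bounded_linear S" "\<And>x y. inner (S x) y = inner x (S y)" "\<And>x. S (S x) = B x"
    "\<And>x. S (mul_i x) = mul_i (S x)" using positive_op_sqrt[OF assms] by blast
  define L where "L = {M. closed_csubspace M \<and> M \<subseteq> closure (range S)}"
  have Q: "quasi_units B = compress S ` L"
    using compress_quasi_unit[OF S] quasi_unit_eq_compress[OF S] unfolding L_def by blast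
  have le_iff: "op_le (compress S M) (compress S N) \<longleftrightarrow> M \<subseteq> N" if "M \<in> L" "N \<in> L" for M N
    using that by (simp add: L_def compress_le_iff[OF S])
  \<comment> \<open>The largest member of \<open>L\<close>; it bounds every pair from above, so the
    family intersected to form \<open>J\<close> is nonempty.\<close>
  have top: "closure (range S) \<in> L"
    by (simp add: L_def closed_csubspace_closure_range[OF bounded_linear.linear[OF S(1)] S(4)])
  have Inter: "\<Inter>\<M> \<in> L" if "\<M> \<subseteq> L" "\<M> \<noteq> {}" for \<M>
    using that closed_csubspace_Inter[of \<M>] by (auto simp: L_def)
  let ?Q = "quasi_unit_order B"
  \<comment> \<open>Antisymmetry follows from \<open>le_iff\<close>: comparison in both directions
    makes the two subspaces equal.\<close>
  have po: "partial_order ?Q"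
    by standard (auto simp: quasi_unit_order_def Q le_iff)
  show ?thesis
  proof (intro lattice.intro upper_semilattice.intro lower_semilattice.intro
      upper_semilattice_axioms.intro lower_semilattice_axioms.intro po)
    fix X Y assume "X \<in> carrier ?Q" "Y \<in> carrier ?Q"
    then obtain M N where MN: "M \<in> L" "N \<in> L" and XY: "X = compress S M" "Y = compress S N"
      by (auto simp: quasi_unit_order_def Q)
    have inf: "M \<inter> N \<in> L" using Inter[of "{M, N}"] MN by simp
    have "greatest ?Q (compress S (M \<inter> N)) (Lower ?Q {X, Y})"
      using MN inf by (auto simp: greatest_def Lower_def quasi_unit_order_def Q XY le_iff)
    then show "\<exists>s. greatest ?Q s (Lower ?Q {X, Y})" by (rule exI[of _ "compress S (M \<inter> N)"])
    \<comment> \<open>The join is taken as the intersection of all upper bounds in \<open>L\<close>,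
      which avoids forming the closure of a sum of subspaces.\<close>
    define J where "J = \<Inter>{V \<in> L. M \<subseteq> V \<and> N \<subseteq> V}"
    have J: "J \<in> L" unfolding J_def using top MN by (intro Inter) (auto simp: L_def)
    have "M \<subseteq> J" "N \<subseteq> J" and "\<And>V. V \<in> L \<Longrightarrow> M \<subseteq> V \<Longrightarrow> N \<subseteq> V \<Longrightarrow> J \<subseteq> V"
      by (auto simp: J_def)
    then have "least ?Q (compress S J) (Upper ?Q {X, Y})"
      using MN J by (auto simp: least_def Upper_def quasi_unit_order_def Q XY le_iff)
    then show "\<exists>s. least ?Q s (Upper ?Q {X, Y})" by (rule exI[of _ "compress S J"])
  qed
qed

end
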